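(* Every tensor in $\mathbb{R}^{2\times2\times2}$ is equivalent, via a transformation in $\mathrm{GL}_2(\mathbb{R})\times\mathrm{GL}_2(\mathbb{R})\times\mathrm{GL}_2(\mathbb{R})$, to precisely one of the following eight canonical forms, with the invariants $(\operatorname{sign}\Delta;\ \operatorname{rank}_\boxplus;\ \operatorname{rank}_\otimes;\ \underline{\operatorname{rank}}_\otimes)$ taking the values shown (writing $\mathbf{e}_{ijk}=\mathbf{e}_i\otimes\mathbf{e}_j\otimes\mathbf{e}_k$): \begin{itemize} \item $D_0=0$: $(0;\ (0,0,0);\ 0;\ 0)$ \item $D_1=\mathbf{e}_{111}$: $(0;\ (1,1,1);\ 1;\ 1)$ \item $D_2=\mathbf{e}_{111}+\mathbf{e}_{122}$: $(0;\ (1,2,2);\ 2;\ 2)$ \item $D_2'=\mathbf{e}_{111}+\mathbf{e}_{212}$: $(0;\ (2,1,2);\ 2;\ 2)$ \item $D_2''=\mathbf{e}_{111}+\mathbf{e}_{221}$: $(0;\ (2,2,1);\ 2;\ 2)$ \item $G_2=\mathbf{e}_{111}+\mathbf{e}_{222}$: $(+;\ (2,2,2);\ 2;\ 2)$ \item $D_3=\mathbf{e}_{111}+\mathbf{e}_{212}+\mathbf{e}_{221}$: $(0;\ (2,2,2);\ 3;\ 2)$ \item $G_3=\mathbf{e}_{111}+\mathbf{e}_{122}-\mathbf{e}_{212}+\mathbf{e}_{221}$: $(-;\ (2,2,2);\ 3;\ 3)$ \end{itemize}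
   Context: $\mathbb{R}^{2\times2\times2}\cong\mathbb{R}^2\otimes\mathbb{R}^2\otimes\mathbb{R}^2$ is the space of real arrays $A=[a_{ijk}]=\sum a_{ijk}\,\mathbf{e}_i\otimes\mathbf{e}_j\otimes\mathbf{e}_k$, with $\mathbf{e}_1,\mathbf{e}_2$ the standard basis. $(L,M,N)$ acts by $(L,M,N)\cdot(\mathbf{x}\otimes\mathbf{y}\otimes\mathbf{z})=L\mathbf{x}\otimes M\mathbf{y}\otimes N\mathbf{z}$, extended linearly; $A,B$ are equivalent if $A=(L,M,N)\cdot B$ with $L,M,N\in\mathrm{GL}_2(\mathbb{R})$. Invariants: (i) with slabs $A_i=[a_{ijk}]_{j,k}\in\mathbb{R}^{2\times2}$, $i=1,2$, $\Delta(A)$ is the discriminant of the quadratic form $\det(\lambda_1A_1+\lambda_2A_2)$ in $(\lambda_1,\lambda_2)$, i.e. $\Delta(A)=\bigl[\tfrac12(\det(A_1+A_2)-\det(A_1-A_2))\bigr]^2-4\det(A_1)\det(A_2)$. (ii) $\operatorname{rank}_\boxplus(A)=(r_1(A),r_2(A),r_3(A))$ is the multilinear rank, where $r_1(A)$ is the dimension of the span of the vectors $(a_{ijk})_i$ over all $(j,k)$, and similarly $r_2,r_3$ for the vectors $(a_{ijk})_j$ and $(a_{ijk})_k$. (iii) $\operatorname{rank}_\otimes(A)$ is the least $r\ge0$ such that $A$ is a sum of $r$ tensors of the form $\mathbf{x}\otimes\mathbf{y}\otimes\mathbf{z}$. (iv) The border rank $\underline{\operatorname{rank}}_\otimes(A)$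 is the least $r\ge 0$ such that $A$ lies in the (Euclidean) closure of $\{B:\operatorname{rank}_\otimes(B)\le r\}$. *)

theory Defs
  imports "HOL-Analysis.Analysis"
begin

text \<open>The entry \<open>a\<^sub>i\<^sub>j\<^sub>k\<close> of \<open>A\<close> is \<open>A $ i $ j $ k\<close>, so \<open>A $ i\<close> is the \<open>i\<close>-th slab, with rows indexed
  by \<open>j\<close> and columns by \<open>k\<close>. The indices \<open>1, 2\<close> are the two elements of the numeral type \<open>2\<close>
  (in which \<open>2 = 0\<close>).\<close>

type_synonym tensor222 = "real ^ 2 ^ 2 ^ 2"

definition outer3 :: "real ^ 2 \<Rightarrow> real ^ 2 \<Rightarrow> real ^ 2 \<Rightarrow> tensor222" where
  "outer3 x y z = (\<chi> i j k. x $ i * y $ j * z $ k)"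

definition ebasis :: "2 \<Rightarrow> 2 \<Rightarrow> 2 \<Rightarrow> tensor222" where
  "ebasis i j k = outer3 (axis i 1) (axis j 1) (axis k 1)"

text \<open>The linear extension of \<open>x \<otimes> y \<otimes> z \<mapsto> L x \<otimes> M y \<otimes> N z\<close>, by its values on the standard basis.\<close>

definition tensor_act ::
  "real ^ 2 ^ 2 \<Rightarrow> real ^ 2 ^ 2 \<Rightarrow> real ^ 2 ^ 2 \<Rightarrow> tensor222 \<Rightarrow> tensor222" where
  "tensor_act L M N A =
     (\<Sum>i\<in>UNIV. \<Sum>j\<in>UNIV. \<Sum>k\<in>UNIV.
        A $ i $ j $ k *\<^sub>R outer3 (L *v axis i 1) (M *v axis j 1) (N *v axis k 1))"

definition tensor_equiv :: "tensor222 \<Rightarrow> tensor222 \<Rightarrow> bool" where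
  "tensor_equiv A B \<longleftrightarrow>
     (\<exists>L M N. invertible L \<and> invertible M \<and> invertible N \<and> A = tensor_act L M N B)"

definition hyperdet :: "tensor222 \<Rightarrow> real" where
  "hyperdet A =
     (1/2 * (det (A $ 1 + A $ 2) - det (A $ 1 - A $ 2)))\<^sup>2 - 4 * det (A $ 1) * det (A $ 2)"

definition multilinear_rank :: "tensor222 \<Rightarrow> nat \<times> nat \<times> nat" where
  "multilinear_rank A =
     (dim (span {(\<chi> i. A $ i $ j $ k) | j k. True}),
      dim (span {(\<chi> j. A $ i $ j $ k) | i k. True}),
      dim (span {(\<chi> k. A $ i $ j $ k) | i j. True}))"

definition tensor_rank :: "tensor222 \<Rightarrow> nat" where
  "tensor_rank A = (LEAST r. \<exists>x y z. A = (\<Sum>s<r. outer3 (x s) (y s) (z s)))"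

text \<open>Some such sum exists, so \<open>LEAST\<close> is not taken over an empty set here or in \<open>border_rank\<close>.\<close>

lemma tensor_rank_exists: "\<exists>(r::nat) x y z. A = (\<Sum>s<r. outer3 (x s) (y s) (z s))"
proof -
  define j k :: "nat \<Rightarrow> 2"
    where "j s = (if s < 2 then 1 else 2)" and "k s = (if s = 0 \<or> s = 2 then 1 else 2)" for s
  define x y z :: "nat \<Rightarrow> real ^ 2"
    where "x s = (\<chi> i. A $ i $ j s $ k s)" and "y s = axis (j s) 1" and "z s = axis (k s) 1" for s
  have "{..<4} = {0, 1, 2, 3 :: nat}"
    by auto
  then have "A = (\<Sum>s<(4::nat). outer3 (x s) (y s) (z s))"
    by (simp add: vec_eq_iff forall_2 outer3_def axis_def x_def y_def z_def j_def k_def)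
  then show ?thesis
    by blast
qed

definition border_rank :: "tensor222 \<Rightarrow> nat" where
  "border_rank A = (LEAST r. A \<in> closure {B. tensor_rank B \<le> r})"

datatype canonical_label = D0 | D1 | D2 | D2' | D2'' | G2 | D3 | G3

primrec canonical_form :: "canonical_label \<Rightarrow> tensor222" where
  "canonical_form D0 = 0"
| "canonical_form D1 = ebasis 1 1 1"
| "canonical_form D2 = ebasis 1 1 1 + ebasis 1 2 2"
| "canonical_form D2' = ebasis 1 1 1 + ebasis 2 1 2"
| "canonical_form D2'' = ebasis 1 1 1 + ebasis 2 2 1"
| "canonical_form G2 = ebasis 1 1 1 + ebasis 2 2 2"
| "canonical_form D3 = ebasis 1 1 1 + ebasis 2 1 2 + ebasis 2 2 1"
| "canonical_form G3 = ebasis 1 1 1 + ebasis 1 2 2 - ebasis 2 1 2 + ebasis 2 2 1"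

definition invariants :: "tensor222 \<Rightarrow> real \<times> (nat \<times> nat \<times> nat) \<times> nat \<times> nat" where
  "invariants A = (sgn (hyperdet A), multilinear_rank A, tensor_rank A, border_rank A)"

primrec listed_invariants :: "canonical_label \<Rightarrow> real \<times> (nat \<times> nat \<times> nat) \<times> nat \<times> nat" where
  "listed_invariants D0 = (0, (0,0,0), 0, 0)"
| "listed_invariants D1 = (0, (1,1,1), 1, 1)"
| "listed_invariants D2 = (0, (1,2,2), 2, 2)"
| "listed_invariants D2' = (0, (2,1,2), 2, 2)"
| "listed_invariants D2'' = (0, (2,2,1), 2, 2)"
| "listed_invariants G2 = (1, (2,2,2), 2, 2)"
| "listed_invariants D3 = (0, (2,2,2), 3, 2)"
| "listed_invariants G3 = (-1, (2,2,2), 3, 3)"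

lemma tensor_act_nth:
  "tensor_act L M N A $ i $ j $ k =
     (\<Sum>a\<in>UNIV. \<Sum>b\<in>UNIV. \<Sum>c\<in>UNIV. L $ i $ a * M $ j $ b * N $ k $ c * A $ a $ b $ c)"
  by (simp add: tensor_act_def outer3_def matrix_vector_mul_component inner_axis mult_ac)

lemma tensor_act_outer3: "tensor_act L M N (outer3 x y z) = outer3 (L *v x) (M *v y) (N *v z)"
  by (simp add: vec_eq_iff tensor_act_nth)
     (simp add: outer3_def matrix_vector_mult_def sum_2 algebra_simps)

lemma linear_tensor_act: "linear (tensor_act L M N)"
  by (rule linearI; simp add: vec_eq_iff tensor_act_nth sum_2 algebra_simps)

end

theory Submission
  imports Defs
begin

text \<open>All four invariants are constant on orbits (the sign of \<open>\<Delta>\<close> because \<open>\<Delta>\<close> is multiplied by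
  \<open>(det L det M det N)\<^sup>2\<close>), and they separate the eight canonical forms. Lower bounds on the border
  rank come from closed polynomial conditions: tensors of rank at most 1 have vanishing flattening
  minors, and tensors of rank at most 2 have \<open>\<Delta> \<ge> 0\<close>, since \<open>\<Delta>(x \<otimes> y \<otimes> z + x' \<otimes> y' \<otimes> z')\<close> is the
  square of \<open>det [x, x'] det [y, y'] det [z, z']\<close>.

  Every tensor reaches a canonical form as a pencil of slabs. If some slab combination is invertible,
  make the slabs \<open>I\<close> and a traceless \<open>B\<close>; then \<open>B\<^sup>2\<close> is scalar, and for \<open>B \<noteq> 0\<close> the sign of this
  scalar decides between \<open>G\<^sub>2\<close>, \<open>D\<^sub>3\<close> and \<open>G\<^sub>3\<close>. Otherwise the pencil is singular, and
  normalising one slab to a matrix unit leaves at most one further entry.\<close>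

section \<open>The group action and its equivalence relation\<close>

lemma tensor_act_compose:
  "tensor_act L M N (tensor_act L' M' N' A) = tensor_act (L ** L') (M ** M') (N ** N') A"
  \<comment> \<open>Only the inner and the composite action are expanded; the outer one passes
    through the sums by linearity and then meets rank-one terms only.\<close>
  unfolding tensor_act_def[of L' M' N'] tensor_act_def[of "L ** L'"]
  by (simp add: linear_sum[OF linear_tensor_act] linear_cmul[OF linear_tensor_act] tensor_act_outer3
      matrix_vector_mul_assoc)

lemma tensor_act_one [simp]: "tensor_act (mat 1) (mat 1) (mat 1) A = A"
  by (simp add: vec_eq_iff tensor_act_nth forall_2 sum_2 mat_def)

lemma tensor_equivI:
  "invertible L \<Longrightarrow> invertible M \<Longrightarrow> invertible N \<Longrightarrow> tensor_equiv (tensor_act L M N A) A"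
  by (auto simp: tensor_equiv_def)

lemma tensor_equiv_sym:
  assumes "tensor_equiv A B"
  shows "tensor_equiv B A"
proof -
  obtain L M N where inv: "invertible L" "invertible M" "invertible N" and A: "A = tensor_act L M N B"
    using assms by (auto simp: tensor_equiv_def)
  obtain L' M' N' where "L' ** L = mat 1" "L ** L' = mat 1" "M' ** M = mat 1" "M ** M' = mat 1"
      "N' ** N = mat 1" "N ** N' = mat 1"
    using inv unfolding invertible_def by blast
  moreover from this have "B = tensor_act L' M' N' A"
    by (simp add: A tensor_act_compose)
  ultimately show ?thesis
    unfolding tensor_equiv_def invertible_def by blast
qed

lemma tensor_equiv_trans [trans]:
  assumes "tensor_equiv A B" "tensor_equiv B C"
  shows "tensor_equiv A C"
  using assms unfolding tensor_equiv_def by (metis tensor_act_compose invertible_mult)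

lemma tensor_equiv_refl [simp]: "tensor_equiv A A"
  using tensor_equivI[of "mat 1" "mat 1" "mat 1" A] by (simp add: invertible_det_nz)

subsection \<open>Invariance\<close>

text \<open>Splitting the action into one factor per mode leaves three small polynomial identities.
  No invertibility is assumed, so singular matrices are covered as well.\<close>

lemma hyperdet_act:
  "hyperdet (tensor_act L M N A) = (det L * det M * det N)\<^sup>2 * hyperdet A"
proof -
  have 1: "hyperdet (tensor_act L (mat 1) (mat 1) A) = (det L)\<^sup>2 * hyperdet A" for L A
    by (simp add: hyperdet_def det_2 tensor_act_nth sum_2 mat_def) algebra
  have 2: "hyperdet (tensor_act (mat 1) M (mat 1) A) = (det M)\<^sup>2 * hyperdet A" for M A
    by (simp add: hyperdet_def det_2 tensor_act_nth sum_2 mat_def) algebra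
  have 3: "hyperdet (tensor_act (mat 1) (mat 1) N A) = (det N)\<^sup>2 * hyperdet A" for N A
    by (simp add: hyperdet_def det_2 tensor_act_nth sum_2 mat_def) algebra
  have "tensor_act L M N A =
      tensor_act L (mat 1) (mat 1) (tensor_act (mat 1) M (mat 1) (tensor_act (mat 1) (mat 1) N A))"
    by (simp add: tensor_act_compose)
  then show ?thesis
    by (simp add: 1 2 3 power_mult_distrib)
qed

lemma sgn_hyperdet_equiv:
  assumes "tensor_equiv A B"
  shows "sgn (hyperdet A) = sgn (hyperdet B)"
proof -
  have "sgn (d\<^sup>2 * h) = sgn h" if "d \<noteq> 0" for d h :: real
    using that by (simp add: sgn_if zero_less_mult_iff)
  then show ?thesis
    using assms by (auto simp: tensor_equiv_def hyperdet_act invertible_det_nz)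
qed

section \<open>Multilinear rank on orbits\<close>

lemma dim_span_le:
  fixes f :: "'a::euclidean_space \<Rightarrow> 'b::euclidean_space"
  assumes "linear f" "S \<subseteq> f ` span T"
  shows "dim (span S) \<le> dim (span T)"
  by (metis assms dim_image_le dim_span dim_subset order.trans)

definition mode_dim1 :: "tensor222 \<Rightarrow> nat" where
  "mode_dim1 A = dim (span {(\<chi> i. A $ i $ j $ k) | j k. True})"

definition mode_dim2 :: "tensor222 \<Rightarrow> nat" where
  "mode_dim2 A = dim (span {(\<chi> j. A $ i $ j $ k) | i k. True})"

definition mode_dim3 :: "tensor222 \<Rightarrow> nat" where
  "mode_dim3 A = dim (span {(\<chi> k. A $ i $ j $ k) | i j. True})"

lemma multilinear_rank_eq: "multilinear_rank A = (mode_dim1 A, mode_dim2 A, mode_dim3 A)"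
  by (simp add: multilinear_rank_def mode_dim1_def mode_dim2_def mode_dim3_def)

text \<open>\<open>M\<close> and \<open>N\<close> only mix the mode-1 fibres, after which
  \<open>L\<close> maps them linearly. An inequality is enough, since equivalence is
  symmetric.\<close>

lemma mode_dim1_act_le: "mode_dim1 (tensor_act L M N A) \<le> mode_dim1 A"
  unfolding mode_dim1_def
proof (rule dim_span_le[where f = "(*v) L"], safe)
  fix j k
  let ?v = "\<Sum>b\<in>UNIV. \<Sum>c\<in>UNIV. (M $ j $ b * N $ k $ c) *\<^sub>R (\<chi> i. A $ i $ b $ c)"
  have "(\<chi> i. tensor_act L M N A $ i $ j $ k) = L *v ?v"
    by (simp add: vec_eq_iff tensor_act_nth forall_2 sum_2 matrix_vector_mult_def algebra_simps)
  moreover have "?v \<in> span {(\<chi> i. A $ i $ j $ k) | j k. True}"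
    by (intro span_sum span_scale span_base) blast
  ultimately show "(\<chi> i. tensor_act L M N A $ i $ j $ k)
      \<in> (*v) L ` span {(\<chi> i. A $ i $ j $ k) | j k. True}"
    by blast
qed (rule matrix_vector_mul_linear)

lemma mode_dim2_act_le: "mode_dim2 (tensor_act L M N A) \<le> mode_dim2 A"
  unfolding mode_dim2_def
proof (rule dim_span_le[where f = "(*v) M"], safe)
  fix i k
  let ?v = "\<Sum>a\<in>UNIV. \<Sum>c\<in>UNIV. (L $ i $ a * N $ k $ c) *\<^sub>R (\<chi> j. A $ a $ j $ c)"
  have "(\<chi> j. tensor_act L M N A $ i $ j $ k) = M *v ?v"
    by (simp add: vec_eq_iff tensor_act_nth forall_2 sum_2 matrix_vector_mult_def algebra_simps)
  moreover have "?v \<in> span {(\<chi> j. A $ i $ j $ k) | i k. True}"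
    by (intro span_sum span_scale span_base) blast
  ultimately show "(\<chi> j. tensor_act L M N A $ i $ j $ k)
      \<in> (*v) M ` span {(\<chi> j. A $ i $ j $ k) | i k. True}"
    by blast
qed (rule matrix_vector_mul_linear)

lemma mode_dim3_act_le: "mode_dim3 (tensor_act L M N A) \<le> mode_dim3 A"
  unfolding mode_dim3_def
proof (rule dim_span_le[where f = "(*v) N"], safe)
  fix i j
  let ?v = "\<Sum>a\<in>UNIV. \<Sum>b\<in>UNIV. (L $ i $ a * M $ j $ b) *\<^sub>R (\<chi> k. A $ a $ b $ k)"
  have "(\<chi> k. tensor_act L M N A $ i $ j $ k) = N *v ?v"
    by (simp add: vec_eq_iff tensor_act_nth forall_2 sum_2 matrix_vector_mult_def algebra_simps)
  moreover have "?v \<in> span {(\<chi> k. A $ i $ j $ k) | i j. True}"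
    by (intro span_sum span_scale span_base) blast
  ultimately show "(\<chi> k. tensor_act L M N A $ i $ j $ k)
      \<in> (*v) N ` span {(\<chi> k. A $ i $ j $ k) | i j. True}"
    by blast
qed (rule matrix_vector_mul_linear)

lemma multilinear_rank_equiv:
  assumes "tensor_equiv A B"
  shows "multilinear_rank A = multilinear_rank B"
proof -
  have "mode_dim1 A \<le> mode_dim1 B \<and> mode_dim2 A \<le> mode_dim2 B \<and> mode_dim3 A \<le> mode_dim3 B"
    if "tensor_equiv A B" for A B
    using that by (auto simp: tensor_equiv_def mode_dim1_act_le mode_dim2_act_le mode_dim3_act_le)
  from this[OF assms] this[OF tensor_equiv_sym[OF assms]] show ?thesis
    by (simp add: multilinear_rank_eq)
qed

section \<open>Tensor rank and border rank on orbits\<close>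

lemma outer3_zero [simp]: "outer3 0 y z = 0"
  by (simp add: outer3_def vec_eq_iff)

text \<open>A shorter decomposition can be padded with zero terms, so a sum of exactly
  \<open>r\<close> terms exists for every \<open>r\<close> from the rank on.\<close>

lemma tensor_rank_le_iff:
  "tensor_rank A \<le> r \<longleftrightarrow> (\<exists>x y z. A = (\<Sum>s<r. outer3 (x s) (y s) (z s)))"
proof
  assume le: "tensor_rank A \<le> r"
  obtain x y z where A: "A = (\<Sum>s<tensor_rank A. outer3 (x s) (y s) (z s))"
    using LeastI_ex[OF tensor_rank_exists[of A]] unfolding tensor_rank_def[symmetric] by blast
  have "(\<Sum>s<tensor_rank A. outer3 (x s) (y s) (z s)) =
      (\<Sum>s<r. outer3 (if s < tensor_rank A then x s else 0) (y s) (z s))"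
    using le by (intro sum.mono_neutral_cong_left) auto
  with A show "\<exists>x y z. A = (\<Sum>s<r. outer3 (x s) (y s) (z s))"
    by (intro exI[of _ "\<lambda>s. if s < tensor_rank A then x s else 0"] exI[of _ y] exI[of _ z]) simp
next
  assume "\<exists>x y z. A = (\<Sum>s<r. outer3 (x s) (y s) (z s))"
  then show "tensor_rank A \<le> r"
    unfolding tensor_rank_def by (rule Least_le)
qed

lemma tensor_rank_act_le: "tensor_rank (tensor_act L M N A) \<le> tensor_rank A"
proof -
  define r where "r = tensor_rank A"
  then obtain x y z where A: "A = (\<Sum>s<r. outer3 (x s) (y s) (z s))"
    using tensor_rank_le_iff[of A r] by auto
  have "tensor_act L M N A = (\<Sum>s<r. outer3 (L *v x s) (M *v y s) (N *v z s))"
    by (simp add: A linear_sum[OF linear_tensor_act] tensor_act_outer3)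
  then show ?thesis
    unfolding tensor_rank_le_iff r_def[symmetric]
    by (intro exI[of _ "\<lambda>s. L *v x s"] exI[of _ "\<lambda>s. M *v y s"] exI[of _ "\<lambda>s. N *v z s"])
qed

text \<open>The sets of tensors of bounded rank grow with the bound, hence so do their closures; the
  tensor rank itself shows that the minimum is attained.\<close>

lemma border_rank_le_iff: "border_rank A \<le> r \<longleftrightarrow> A \<in> closure {B. tensor_rank B \<le> r}"
proof
  have "A \<in> closure {B. tensor_rank B \<le> tensor_rank A}"
    by (rule subsetD[OF closure_subset]) simp
  then have "A \<in> closure {B. tensor_rank B \<le> border_rank A}"
    unfolding border_rank_def by (rule LeastI)
  moreover assume "border_rank A \<le> r"
  then have "closure {B. tensor_rank B \<le> border_rank A} \<subseteq> closure {B. tensor_rank B \<le> r}"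
    by (intro closure_mono) auto
  ultimately show "A \<in> closure {B. tensor_rank B \<le> r}"
    by blast
qed (auto simp: border_rank_def intro: Least_le)

lemma border_rank_le_tensor_rank: "border_rank A \<le> tensor_rank A"
  unfolding border_rank_le_iff by (rule subsetD[OF closure_subset]) simp

text \<open>The action is linear, hence continuous here, so it carries limits of low-rank tensors to
  limits of tensors whose rank is no larger.\<close>

lemma border_rank_act_le: "border_rank (tensor_act L M N A) \<le> border_rank A"
proof -
  let ?S = "{B. tensor_rank B \<le> border_rank A}"
  have "tensor_act L M N A \<in> tensor_act L M N ` closure ?S"
    using border_rank_le_iff[of A "border_rank A"] by simp
  also have "\<dots> \<subseteq> closure (tensor_act L M N ` ?S)"
    by (intro closure_linear_image_subset linear_tensor_act)
  also have "\<dots> \<subseteq> closure ?S"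
    by (intro closure_mono) (auto intro: order_trans[OF tensor_rank_act_le])
  finally show ?thesis
    by (simp add: border_rank_le_iff)
qed

lemma ranks_equiv:
  assumes "tensor_equiv A B"
  shows "tensor_rank A = tensor_rank B" "border_rank A = border_rank B"
proof -
  have "tensor_rank A \<le> tensor_rank B \<and> border_rank A \<le> border_rank B"
    if "tensor_equiv A B" for A B
    using that by (auto simp: tensor_equiv_def tensor_rank_act_le border_rank_act_le)
  from this[OF assms] this[OF tensor_equiv_sym[OF assms]]
  show "tensor_rank A = tensor_rank B" "border_rank A = border_rank B"
    by simp_all
qed

lemma invariants_equiv: "tensor_equiv A B \<Longrightarrow> invariants A = invariants B"
  by (simp add: invariants_def sgn_hyperdet_equiv multilinear_rank_equiv ranks_equiv)

subsection \<open>Rank bounds\<close>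

text \<open>A closed condition satisfied by all tensors of rank at most \<open>r\<close> passes to
  their limits, so a tensor violating it has larger border rank.\<close>

lemma border_rank_geI:
  assumes "closed C" "\<And>B. tensor_rank B \<le> r \<Longrightarrow> B \<in> C" "A \<notin> C"
  shows "r < border_rank A"
proof (rule ccontr)
  assume "\<not> r < border_rank A"
  then have "A \<in> closure {B. tensor_rank B \<le> r}"
    by (simp only: border_rank_le_iff[symmetric] not_less)
  also have "\<dots> \<subseteq> C"
    using assms by (intro closure_minimal) auto
  finally show False
    using assms by simp
qed

lemma tensor_rank_leI:
  "tensor_rank 0 \<le> 0"
  "tensor_rank (outer3 x1 y1 z1) \<le> 1"
  "tensor_rank (outer3 x1 y1 z1 + outer3 x2 y2 z2) \<le> 2"
  "tensor_rank (outer3 x1 y1 z1 + outer3 x2 y2 z2 + outer3 x3 y3 z3) \<le> 3"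
proof -
  let ?f = "\<lambda>a b c s. if s = (0::nat) then a else if s = 1 then b else (c :: real^2)"
  show "tensor_rank 0 \<le> 0"
    by (simp only: tensor_rank_le_iff) simp
  show "tensor_rank (outer3 x1 y1 z1) \<le> 1"
    unfolding tensor_rank_le_iff
    by (intro exI[of _ "\<lambda>_. x1"] exI[of _ "\<lambda>_. y1"] exI[of _ "\<lambda>_. z1"]) simp
  show "tensor_rank (outer3 x1 y1 z1 + outer3 x2 y2 z2) \<le> 2"
    unfolding tensor_rank_le_iff
    by (intro exI[of _ "?f x1 x2 0"] exI[of _ "?f y1 y2 0"] exI[of _ "?f z1 z2 0"])
       (simp add: numeral_2_eq_2)
  show "tensor_rank (outer3 x1 y1 z1 + outer3 x2 y2 z2 + outer3 x3 y3 z3) \<le> 3"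
    unfolding tensor_rank_le_iff
    by (intro exI[of _ "?f x1 x2 x3"] exI[of _ "?f y1 y2 y3"] exI[of _ "?f z1 z2 z3"])
       (simp add: numeral_3_eq_3)
qed

lemma tensor_rank_le_1D:
  assumes "tensor_rank A \<le> 1"
  obtains x y z where "A = outer3 x y z"
  using assms by (auto simp: tensor_rank_le_iff)

lemma tensor_rank_le_2D:
  assumes "tensor_rank A \<le> 2"
  obtains x1 y1 z1 x2 y2 z2 where "A = outer3 x1 y1 z1 + outer3 x2 y2 z2"
  using assms by (auto simp: tensor_rank_le_iff numeral_2_eq_2)

lemma border_rank_pos: "A \<noteq> 0 \<Longrightarrow> 0 < border_rank A"
  by (rule border_rank_geI[of "{0}"]) (auto simp del: le_zero_eq simp add: tensor_rank_le_iff)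

lemma border_rank_gt_1_minor1:
  assumes "A $ i $ j $ k * A $ i' $ j' $ k' \<noteq> A $ i' $ j $ k * A $ i $ j' $ k'"
  shows "1 < border_rank A"
proof (rule border_rank_geI)
  let ?C = "{A :: tensor222. A $ i $ j $ k * A $ i' $ j' $ k' = A $ i' $ j $ k * A $ i $ j' $ k'}"
  show "closed ?C"
    by (intro closed_Collect_eq continuous_intros)
  show "B \<in> ?C" if "tensor_rank B \<le> 1" for B
    using that by (rule tensor_rank_le_1D) (simp add: outer3_def)
qed (use assms in simp)

text \<open>Needed for \<open>D2\<close>: its second slab vanishes, so all minors of the first
  flattening are zero.\<close>

lemma border_rank_gt_1_minor2:
  assumes "A $ i $ j $ k * A $ i' $ j' $ k' \<noteq> A $ i $ j' $ k * A $ i' $ j $ k'"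
  shows "1 < border_rank A"
proof (rule border_rank_geI)
  let ?C = "{A :: tensor222. A $ i $ j $ k * A $ i' $ j' $ k' = A $ i $ j' $ k * A $ i' $ j $ k'}"
  show "closed ?C"
    by (intro closed_Collect_eq continuous_intros)
  show "B \<in> ?C" if "tensor_rank B \<le> 1" for B
    using that by (rule tensor_rank_le_1D) (simp add: outer3_def)
qed (use assms in simp)

text \<open>The sum is the image of \<open>G2\<close> under the matrices with columns
  \<open>x, x'\<close>, \<open>y, y'\<close> and \<open>z, z'\<close>, which may be
  singular.\<close>

lemma hyperdet_outer3_add:
  "hyperdet (outer3 x y z + outer3 x' y' z') =
     ((x $ 1 * x' $ 2 - x $ 2 * x' $ 1) * (y $ 1 * y' $ 2 - y $ 2 * y' $ 1) *
      (z $ 1 * z' $ 2 - z $ 2 * z' $ 1))\<^sup>2"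
proof -
  let ?M = "\<lambda>v w :: real ^ 2. \<chi> i j. if j = 1 then v $ i else w $ i"
  have "outer3 x y z + outer3 x' y' z' =
      tensor_act (?M x x') (?M y y') (?M z z') (ebasis 1 1 1 + ebasis 2 2 2)"
    by (simp add: vec_eq_iff tensor_act_nth sum_2 ebasis_def outer3_def axis_def)
  moreover have "hyperdet (ebasis 1 1 1 + ebasis 2 2 2) = 1"
    by (simp add: hyperdet_def det_2 ebasis_def outer3_def axis_def)
  ultimately show ?thesis
    by (simp add: hyperdet_act det_2 mult.commute)
qed

lemma border_rank_gt_2:
  assumes "hyperdet A < 0"
  shows "2 < border_rank A"
proof (rule border_rank_geI)
  show "closed {A. 0 \<le> hyperdet A}"
    unfolding hyperdet_def det_2 by (intro closed_Collect_le continuous_intros)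
  show "B \<in> {A. 0 \<le> hyperdet A}" if "tensor_rank B \<le> 2" for B
    using that by (rule tensor_rank_le_2D) (simp add: hyperdet_outer3_add)
qed (use assms in simp)

subsection \<open>Tensors as pairs of slabs\<close>

definition slabs :: "real ^ 2 ^ 2 \<Rightarrow> real ^ 2 ^ 2 \<Rightarrow> tensor222" where
  "slabs P Q = vector [P, Q]"

definition mat2 :: "real \<Rightarrow> real \<Rightarrow> real \<Rightarrow> real \<Rightarrow> real ^ 2 ^ 2" where
  "mat2 a b c d = vector [vector [a, b], vector [c, d]]"

lemma slabs_nth [simp]: "slabs P Q $ 1 = P" "slabs P Q $ 2 = Q"
  by (simp_all add: slabs_def vector_2)

lemma mat2_nth [simp]:
  "mat2 a b c d $ 1 $ 1 = a" "mat2 a b c d $ 1 $ 2 = b"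
  "mat2 a b c d $ 2 $ 1 = c" "mat2 a b c d $ 2 $ 2 = d"
  by (simp_all add: mat2_def vector_2)

lemma slabs_collapse: "slabs (A $ 1) (A $ 2) = A"
  by (simp add: vec_eq_iff forall_2)

lemma mat2_collapse: "mat2 (P $ 1 $ 1) (P $ 1 $ 2) (P $ 2 $ 1) (P $ 2 $ 2) = P"
  by (simp add: vec_eq_iff forall_2)

lemma mat2_cases: obtains a b c d where "P = mat2 a b c d"
  using mat2_collapse[of P] by metis

lemma det_mat2 [simp]: "det (mat2 a b c d) = a * d - b * c"
  by (simp add: det_2)

lemma invertible_mat2: "a * d - b * c \<noteq> 0 \<Longrightarrow> invertible (mat2 a b c d)"
  by (simp add: invertible_det_nz)

lemma mat2_mult [simp]:
  "mat2 a b c d ** mat2 e f g h =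
     mat2 (a * e + b * g) (a * f + b * h) (c * e + d * g) (c * f + d * h)"
  by (simp add: vec_eq_iff forall_2 matrix_matrix_mult_def sum_2)

lemma mat2_add [simp]: "mat2 a b c d + mat2 e f g h = mat2 (a + e) (b + f) (c + g) (d + h)"
  by (simp add: vec_eq_iff forall_2)

lemma mat2_scaleR [simp]: "r *\<^sub>R mat2 a b c d = mat2 (r * a) (r * b) (r * c) (r * d)"
  by (simp add: vec_eq_iff forall_2)

lemma mat2_eq_iff [simp]: "mat2 a b c d = mat2 e f g h \<longleftrightarrow> a = e \<and> b = f \<and> c = g \<and> d = h"
  by (auto simp: vec_eq_iff forall_2)

lemma zero_mat2: "0 = mat2 0 0 0 0"
  by (simp add: vec_eq_iff forall_2)

lemma mat_1_mat2: "mat 1 = mat2 1 0 0 1"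
  by (simp add: vec_eq_iff forall_2 mat_def)

lemma canonical_form_slabs:
  "canonical_form D0 = slabs (mat2 0 0 0 0) (mat2 0 0 0 0)"
  "canonical_form D1 = slabs (mat2 1 0 0 0) (mat2 0 0 0 0)"
  "canonical_form D2 = slabs (mat2 1 0 0 1) (mat2 0 0 0 0)"
  "canonical_form D2' = slabs (mat2 1 0 0 0) (mat2 0 1 0 0)"
  "canonical_form D2'' = slabs (mat2 1 0 0 0) (mat2 0 0 1 0)"
  "canonical_form G2 = slabs (mat2 1 0 0 0) (mat2 0 0 0 1)"
  "canonical_form D3 = slabs (mat2 1 0 0 0) (mat2 0 1 1 0)"
  "canonical_form G3 = slabs (mat2 1 0 0 1) (mat2 0 (-1) 1 0)"
  by (simp_all add: vec_eq_iff forall_2 ebasis_def outer3_def axis_def)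

lemma slabs_mult_equiv:
  assumes "invertible M" "invertible N"
  shows "tensor_equiv (slabs P Q) (slabs (M ** P ** N) (M ** Q ** N))"
proof -
  \<comment> \<open>The third factor acts on column indices from the left, so right multiplication
    by \<open>N\<close> appears as its transpose.\<close>
  have "slabs (M ** P ** N) (M ** Q ** N) = tensor_act (mat 1) M (transpose N) (slabs P Q)"
    by (simp add: vec_eq_iff tensor_act_nth forall_2 sum_2 mat_def transpose_def
        matrix_matrix_mult_def algebra_simps)
  moreover have "tensor_equiv \<dots> (slabs P Q)"
    using assms by (intro tensor_equivI) (simp_all add: invertible_det_nz)
  ultimately show ?thesis
    by (simp add: tensor_equiv_sym)
qed

lemma slabs_combine_equiv:
  assumes "a * d - b * c \<noteq> 0"
  shows "tensor_equiv (slabs P Q) (slabs (a *\<^sub>R P + b *\<^sub>R Q) (c *\<^sub>R P + d *\<^sub>R Q))"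
proof -
  have "slabs (a *\<^sub>R P + b *\<^sub>R Q) (c *\<^sub>R P + d *\<^sub>R Q) =
      tensor_act (mat2 a b c d) (mat 1) (mat 1) (slabs P Q)"
    by (simp add: vec_eq_iff tensor_act_nth forall_2 sum_2 mat_def)
  moreover have "tensor_equiv \<dots> (slabs P Q)"
    using assms by (intro tensor_equivI) (simp_all add: invertible_det_nz)
  ultimately show ?thesis
    by (simp add: tensor_equiv_sym)
qed

subsection \<open>Invariants of the canonical forms\<close>

lemma dim_span_eq_1:
  fixes v :: "real ^ 2"
  assumes "v \<in> S" "v \<noteq> 0" "S \<subseteq> span {v}"
  shows "dim (span S) = 1"
proof -
  have "span S = span {v}"
    using assms by (intro span_eq[THEN iffD2]) (auto intro: span_base)
  then show ?thesis
    using assms by (simp add: dim_insert)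
qed

lemma dim_span_eq_2:
  fixes x y :: "real ^ 2"
  assumes "x \<in> S" "y \<in> S" and nz: "x $ 1 * y $ 2 \<noteq> x $ 2 * y $ 1"
  shows "dim (span S) = 2"
proof -
  have "v \<in> span S" for v
  proof -
    define d where "d = x $ 1 * y $ 2 - x $ 2 * y $ 1"
    have "d \<noteq> 0"
      using nz by (simp add: d_def)
    \<comment> \<open>Cramer's rule for the coordinates of \<open>v\<close> in the basis
      \<open>x, y\<close>.\<close>
    then have "v = ((v $ 1 * y $ 2 - v $ 2 * y $ 1) / d) *\<^sub>R x +
        ((x $ 1 * v $ 2 - x $ 2 * v $ 1) / d) *\<^sub>R y"
      by (simp add: vec_eq_iff forall_2 field_simps) (simp add: d_def algebra_simps)
    also have "\<dots> \<in> span S"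
      using assms by (intro span_add span_scale span_base)
    finally show ?thesis .
  qed
  then have "span S = UNIV"
    by blast
  then show ?thesis
    by simp
qed

text \<open>All fibres of the mode lie on the first coordinate axis, and the one through the entry
  at \<open>1, 1, 1\<close> is nonzero.\<close>

lemma mode_dim_eq_1:
  assumes "A $ 1 $ 1 $ 1 \<noteq> 0"
  shows "\<forall>j k. A $ 2 $ j $ k = 0 \<Longrightarrow> mode_dim1 A = 1"
    and "\<forall>i k. A $ i $ 2 $ k = 0 \<Longrightarrow> mode_dim2 A = 1"
    and "\<forall>i j. A $ i $ j $ 2 = 0 \<Longrightarrow> mode_dim3 A = 1"
proof -
  have in_span: "w \<in> span {v}" if "v $ 1 \<noteq> 0" "v $ 2 = 0" "w $ 2 = 0" for v w :: "real ^ 2"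
    using that by (auto simp: span_singleton vec_eq_iff forall_2 image_iff intro!: exI[of _ "w $ 1 / v $ 1"])
  show "mode_dim1 A = 1" if "\<forall>j k. A $ 2 $ j $ k = 0"
    unfolding mode_dim1_def using assms that
    by (intro dim_span_eq_1[of "\<chi> i. A $ i $ 1 $ 1"])
       (auto simp: vec_eq_iff intro!: in_span exI[of _ 1])
  show "mode_dim2 A = 1" if "\<forall>i k. A $ i $ 2 $ k = 0"
    unfolding mode_dim2_def using assms that
    by (intro dim_span_eq_1[of "\<chi> j. A $ 1 $ j $ 1"])
       (auto simp: vec_eq_iff intro!: in_span exI[of _ 1])
  show "mode_dim3 A = 1" if "\<forall>i j. A $ i $ j $ 2 = 0"
    unfolding mode_dim3_def using assms that
    by (intro dim_span_eq_1[of "\<chi> k. A $ 1 $ 1 $ k"])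
       (auto simp: vec_eq_iff intro!: in_span exI[of _ 1])
qed

text \<open>A nonvanishing minor of the flattening exhibits two independent fibres.\<close>

lemma mode_dim_eq_2:
  "A $ 1 $ j $ k * A $ 2 $ j' $ k' \<noteq> A $ 2 $ j $ k * A $ 1 $ j' $ k' \<Longrightarrow> mode_dim1 A = 2"
  "A $ i $ 1 $ k * A $ i' $ 2 $ k' \<noteq> A $ i $ 2 $ k * A $ i' $ 1 $ k' \<Longrightarrow> mode_dim2 A = 2"
  "A $ i $ j $ 1 * A $ i' $ j' $ 2 \<noteq> A $ i $ j $ 2 * A $ i' $ j' $ 1 \<Longrightarrow> mode_dim3 A = 2"
proof -
  show "mode_dim1 A = 2" if "A $ 1 $ j $ k * A $ 2 $ j' $ k' \<noteq> A $ 2 $ j $ k * A $ 1 $ j' $ k'"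
    unfolding mode_dim1_def
    by (rule dim_span_eq_2[of "\<chi> i. A $ i $ j $ k" _ "\<chi> i. A $ i $ j' $ k'"]) (use that in auto)
  show "mode_dim2 A = 2" if "A $ i $ 1 $ k * A $ i' $ 2 $ k' \<noteq> A $ i $ 2 $ k * A $ i' $ 1 $ k'"
    unfolding mode_dim2_def
    by (rule dim_span_eq_2[of "\<chi> j. A $ i $ j $ k" _ "\<chi> j. A $ i' $ j $ k'"]) (use that in auto)
  show "mode_dim3 A = 2" if "A $ i $ j $ 1 * A $ i' $ j' $ 2 \<noteq> A $ i $ j $ 2 * A $ i' $ j' $ 1"
    unfolding mode_dim3_def
    by (rule dim_span_eq_2[of "\<chi> k. A $ i $ j $ k" _ "\<chi> k. A $ i' $ j' $ k"]) (use that in auto)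
qed

lemma multilinear_rank_0: "multilinear_rank 0 = (0, 0, 0)"
proof -
  have "{\<chi> i. 0 | j k. True} = {0 :: real ^ 2}"
    by (auto simp: vec_eq_iff)
  then show ?thesis
    by (simp add: multilinear_rank_def)
qed

lemma multilinear_rank_canonical:
  "multilinear_rank (canonical_form c) = fst (snd (listed_invariants c))"
proof (cases c)
  case D0
  then show ?thesis
    by (simp add: multilinear_rank_0)
next
  case D1
  show ?thesis
    using mode_dim_eq_1(1)[of "canonical_form c"]
      mode_dim_eq_1(2)[of "canonical_form c"]
      mode_dim_eq_1(3)[of "canonical_form c"]
    unfolding D1 canonical_form_slabs multilinear_rank_eq by (simp add: forall_2)
next
  case D2
  show ?thesis
    using mode_dim_eq_1(1)[of "canonical_form c"]
      mode_dim_eq_2(2)[of "canonical_form c" 1 1 1 2]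
      mode_dim_eq_2(3)[of "canonical_form c" 1 1 1 2]
    unfolding D2 canonical_form_slabs multilinear_rank_eq by (simp add: forall_2)
next
  case D2'
  show ?thesis
    using mode_dim_eq_2(1)[of "canonical_form c" 1 1 1 2]
      mode_dim_eq_1(2)[of "canonical_form c"]
      mode_dim_eq_2(3)[of "canonical_form c" 1 1 2 1]
    unfolding D2' canonical_form_slabs multilinear_rank_eq by (simp add: forall_2)
next
  case D2''
  show ?thesis
    using mode_dim_eq_2(1)[of "canonical_form c" 1 1 2 1]
      mode_dim_eq_2(2)[of "canonical_form c" 1 1 2 1]
      mode_dim_eq_1(3)[of "canonical_form c"]
    unfolding D2'' canonical_form_slabs multilinear_rank_eq by (simp add: forall_2)
next
  case G2
  show ?thesis
    using mode_dim_eq_2(1)[of "canonical_form c" 1 1 2 2]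
      mode_dim_eq_2(2)[of "canonical_form c" 1 1 2 2]
      mode_dim_eq_2(3)[of "canonical_form c" 1 1 2 2]
    unfolding G2 canonical_form_slabs multilinear_rank_eq by (simp add: forall_2)
next
  case D3
  show ?thesis
    using mode_dim_eq_2(1)[of "canonical_form c" 1 1 1 2]
      mode_dim_eq_2(2)[of "canonical_form c" 1 1 2 1]
      mode_dim_eq_2(3)[of "canonical_form c" 1 1 2 1]
    unfolding D3 canonical_form_slabs multilinear_rank_eq by (simp add: forall_2)
next
  case G3
  show ?thesis
    using mode_dim_eq_2(1)[of "canonical_form c" 1 1 2 1]
      mode_dim_eq_2(2)[of "canonical_form c" 1 1 1 2]
      mode_dim_eq_2(3)[of "canonical_form c" 1 1 1 2]
    unfolding G3 canonical_form_slabs multilinear_rank_eq by (simp add: forall_2)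
qed

lemma sgn_hyperdet_canonical: "sgn (hyperdet (canonical_form c)) = fst (listed_invariants c)"
  by (cases c; simp only: canonical_form_slabs; simp add: hyperdet_def det_2)

text \<open>No closed condition can show this, as the border rank is 2. Instead, vanishing of the
  hyperdeterminant forces one of the three pairs of vectors to be dependent, which kills a slice
  determinant that equals 1.\<close>

lemma tensor_rank_D3_gt_2: "2 < tensor_rank (canonical_form D3)"
proof (rule ccontr)
  assume "\<not> 2 < tensor_rank (canonical_form D3)"
  then have "tensor_rank (canonical_form D3) \<le> 2"
    by linarith
  then obtain x y z x' y' z' where eq: "canonical_form D3 = outer3 x y z + outer3 x' y' z'"
    by (rule tensor_rank_le_2D)
  define T where "T = canonical_form D3"
  have entry: "T $ i $ j $ k = x $ i * y $ j * z $ k + x' $ i * y' $ j * z' $ k" for i j k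
    by (simp only: T_def eq) (simp add: outer3_def)
  \<comment> \<open>Determinants of the slices with \<open>j = 1\<close> and with
    \<open>k = 1\<close>. The first is divisible by the determinants of both \<open>x, x'\<close>
    and \<open>z, z'\<close>, the second by that of \<open>y, y'\<close>, so two slices serve all
    three cases.\<close>
  have T: "T $ 1 $ 1 $ 1 * T $ 2 $ 1 $ 2 - T $ 2 $ 1 $ 1 * T $ 1 $ 1 $ 2 = 1"
    "T $ 1 $ 1 $ 1 * T $ 2 $ 2 $ 1 - T $ 1 $ 2 $ 1 * T $ 2 $ 1 $ 1 = 1"
    unfolding T_def canonical_form_slabs by simp_all
  have "hyperdet (canonical_form D3) = 0"
    by (simp only: canonical_form_slabs) (simp add: hyperdet_def det_2)
  then consider "x $ 1 * x' $ 2 - x $ 2 * x' $ 1 = 0" | "y $ 1 * y' $ 2 - y $ 2 * y' $ 1 = 0"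
    | "z $ 1 * z' $ 2 - z $ 2 * z' $ 1 = 0"
    unfolding eq hyperdet_outer3_add by auto
  then show False
  proof cases
    case 1
    have "T $ 1 $ 1 $ 1 * T $ 2 $ 1 $ 2 - T $ 2 $ 1 $ 1 * T $ 1 $ 1 $ 2 =
        (x $ 1 * x' $ 2 - x $ 2 * x' $ 1) *
        (y $ 1 * z $ 1 * y' $ 1 * z' $ 2 - y' $ 1 * z' $ 1 * y $ 1 * z $ 2)"
      by (simp add: entry algebra_simps)
    with 1 T show False
      by simp
  next
    case 2
    have "T $ 1 $ 1 $ 1 * T $ 2 $ 2 $ 1 - T $ 1 $ 2 $ 1 * T $ 2 $ 1 $ 1 =
        (y $ 1 * y' $ 2 - y $ 2 * y' $ 1) *
        (x $ 1 * z $ 1 * x' $ 2 * z' $ 1 - x' $ 1 * z' $ 1 * x $ 2 * z $ 1)"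
      by (simp add: entry algebra_simps)
    with 2 T show False
      by simp
  next
    case 3
    have "T $ 1 $ 1 $ 1 * T $ 2 $ 1 $ 2 - T $ 2 $ 1 $ 1 * T $ 1 $ 1 $ 2 =
        (z $ 1 * z' $ 2 - z $ 2 * z' $ 1) *
        (x $ 1 * y $ 1 * x' $ 2 * y' $ 1 - x' $ 1 * y' $ 1 * x $ 2 * y $ 1)"
      by (simp add: entry algebra_simps)
    with 3 T show False
      by simp
  qed
qed

text \<open>\<open>D\<^sub>3\<close> is the derivative at \<open>t = 0\<close> of \<open>(e\<^sub>2 + t e\<^sub>1) \<otimes> (e\<^sub>1 + t e\<^sub>2) \<otimes> (e\<^sub>1 + t e\<^sub>2)\<close>, hence a limit
  of difference quotients, which have rank at most 2.\<close>

lemma border_rank_D3_le_2: "border_rank (canonical_form D3) \<le> 2"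
proof -
  \<comment> \<open>The difference quotient with \<open>t\<close> cancelled, so that it also makes
    sense and is continuous at 0.\<close>
  define B :: "real \<Rightarrow> tensor222" where "B t = slabs (mat2 1 t t (t\<^sup>2)) (mat2 0 1 1 t)" for t
  have "tensor_rank (B t) \<le> 2" if "t \<noteq> 0" for t
  proof -
    have "B t = outer3 (vector [1, 1 / t]) (vector [1, t]) (vector [1, t])
        + outer3 (vector [0, - 1 / t]) (vector [1, 0]) (vector [1, 0])"
      using that by (simp add: B_def vec_eq_iff forall_2 outer3_def vector_2 power2_eq_square)
    then show ?thesis
      by (simp only: tensor_rank_leI)
  qed
  moreover have "(\<lambda>n. B (inverse (real (Suc n)))) \<longlonglongrightarrow> B 0"
  proof (intro vec_tendstoI)
    fix i j k :: 2
    have "continuous_on UNIV (\<lambda>t. B t $ i $ j $ k)"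
      using exhaust_2[of i] exhaust_2[of j] exhaust_2[of k]
      by (elim disjE; simp add: B_def continuous_on_power)
    then show "(\<lambda>n. B (inverse (real (Suc n))) $ i $ j $ k) \<longlonglongrightarrow> B 0 $ i $ j $ k"
      by (rule continuous_on_tendsto_compose) (use LIMSEQ_inverse_real_of_nat in auto)
  qed
  moreover have "B 0 = canonical_form D3"
    by (simp only: B_def canonical_form_slabs) simp
  ultimately show ?thesis
    unfolding border_rank_le_iff closure_sequential
    by (intro exI[of _ "\<lambda>n. B (inverse (real (Suc n)))"]) (simp del: canonical_form.simps)
qed

lemma tensor_rank_G3_le_3: "tensor_rank (canonical_form G3) \<le> 3"
proof -
  \<comment> \<open>The second slab is \<open>diag(1, -1)\<close> plus a matrix of rank 1; the first
    two terms produce this diagonal part together with the identity slab.\<close>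
  have "canonical_form G3 = outer3 (vector [1, 1]) (vector [1, 0]) (vector [1, 0])
      + outer3 (vector [1, - 1]) (vector [0, 1]) (vector [0, 1])
      + outer3 (vector [0, 1]) (vector [- 1, 1]) (vector [1, 1])"
    by (simp only: canonical_form_slabs) (simp add: vec_eq_iff forall_2 outer3_def vector_2)
  then show ?thesis
    by (simp only: tensor_rank_leI)
qed

lemma ranks_canonical:
  "(tensor_rank (canonical_form c), border_rank (canonical_form c)) = snd (snd (listed_invariants c))"
proof -
  note entries = canonical_form_slabs slabs_nth mat2_nth
  \<comment> \<open>Border rank never exceeds tensor rank, so these bounds pin both to
    \<open>r\<close>. Every form but \<open>D3\<close>, where the two ranks differ, is settled this
    way.\<close>
  have eqI: ?thesis if "tensor_rank (canonical_form c) \<le> r" "r \<le> border_rank (canonical_form c)"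
    "snd (snd (listed_invariants c)) = (r, r)" for r
    using that border_rank_le_tensor_rank[of "canonical_form c"] by simp
  show ?thesis
  proof (cases c)
    case D0
    show ?thesis
      by (rule eqI[of 0]) (use tensor_rank_leI(1) in \<open>simp_all add: D0\<close>)
  next
    case D1
    have "canonical_form D1 \<noteq> 0"
      unfolding entries by (auto simp: vec_eq_iff forall_2)
    then show ?thesis
      by (intro eqI[of 1])
         (use border_rank_pos tensor_rank_leI(2) in \<open>force simp: D1 ebasis_def Suc_le_eq\<close>)+
  next
    case D2
    have "1 < border_rank (canonical_form D2)"
      by (rule border_rank_gt_1_minor2[of _ 1 1 1 1 2 2], unfold entries) simp
    then show ?thesis
      by (intro eqI[of 2]) (use tensor_rank_leI(3) in \<open>simp_all add: D2 ebasis_def\<close>)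
  next
    case D2'
    have "1 < border_rank (canonical_form D2')"
      by (rule border_rank_gt_1_minor1[of _ 1 1 1 2 1 2], unfold entries) simp
    then show ?thesis
      by (intro eqI[of 2]) (use tensor_rank_leI(3) in \<open>simp_all add: D2' ebasis_def\<close>)
  next
    case D2''
    have "1 < border_rank (canonical_form D2'')"
      by (rule border_rank_gt_1_minor1[of _ 1 1 1 2 2 1], unfold entries) simp
    then show ?thesis
      by (intro eqI[of 2]) (use tensor_rank_leI(3) in \<open>simp_all add: D2'' ebasis_def\<close>)
  next
    case G2
    have "1 < border_rank (canonical_form G2)"
      by (rule border_rank_gt_1_minor1[of _ 1 1 1 2 2 2], unfold entries) simp
    then show ?thesis
      by (intro eqI[of 2]) (use tensor_rank_leI(3) in \<open>simp_all add: G2 ebasis_def\<close>)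
  next
    case D3
    have "1 < border_rank (canonical_form D3)"
      by (rule border_rank_gt_1_minor1[of _ 1 1 1 2 1 2], unfold entries) simp
    moreover have "tensor_rank (canonical_form D3) \<le> 3"
      by (simp add: ebasis_def tensor_rank_leI)
    ultimately show ?thesis
      using border_rank_D3_le_2 tensor_rank_D3_gt_2 by (simp add: D3 del: canonical_form.simps)
  next
    case G3
    have "hyperdet (canonical_form G3) < 0"
      using sgn_hyperdet_canonical[of G3] by (simp add: sgn_if del: canonical_form.simps split: if_splits)
    from border_rank_gt_2[OF this] tensor_rank_G3_le_3 show ?thesis
      by (intro eqI[of 3]) (simp_all add: G3 del: canonical_form.simps)
  qed
qed

lemma invariants_canonical: "invariants (canonical_form c) = listed_invariants c"
  using ranks_canonical[of c]
  by (simp add: invariants_def sgn_hyperdet_canonical multilinear_rank_canonical)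

text \<open>The multilinear rank separates all forms except \<open>G2\<close>, \<open>D3\<close> and
  \<open>G3\<close>, which the sign of the hyperdeterminant tells apart.\<close>

lemma listed_invariants_inject: "listed_invariants c = listed_invariants d \<Longrightarrow> c = d"
  by (cases c; cases d; simp)

subsection \<open>Reduction to canonical form\<close>

lemma slabs_swap_equiv: "tensor_equiv (slabs P Q) (slabs Q P)"
  \<comment> \<open>The coefficients are instantiated in the order \<open>a\<close>,
    \<open>d\<close>, \<open>b\<close>, \<open>c\<close>.\<close>
  using slabs_combine_equiv[of 0 0 1 1 P Q] by simp

text \<open>Permutations bring a nonzero entry to the top left, and row and column elimination
  clears the rest: the last entry left is the determinant over the pivot, which is 0.\<close>

lemma singular_matrix_normal_form:
  fixes P :: "real ^ 2 ^ 2"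
  assumes "P \<noteq> 0" "det P = 0"
  obtains M N where "invertible M" "invertible N" "M ** P ** N = mat2 1 0 0 0"
proof -
  let ?I = "mat2 1 0 0 1" and ?W = "mat2 0 1 1 0"
  obtain R C where R: "R \<in> {?I, ?W}" and C: "C \<in> {?I, ?W}" and nz: "(R ** P ** C) $ 1 $ 1 \<noteq> 0"
  proof -
    obtain a b c d where P: "P = mat2 a b c d"
      by (rule mat2_cases)
    show thesis
      using \<open>P \<noteq> 0\<close> that[of ?I ?I] that[of ?I ?W] that[of ?W ?I] that[of ?W ?W]
      by (auto simp: P zero_mat2)
  qed
  obtain a b c d where RPC: "R ** P ** C = mat2 a b c d"
    by (rule mat2_cases)
  have "det (R ** P ** C) = 0"
    using assms by (simp add: det_mul)
  with nz have a: "a \<noteq> 0" "d = b * c / a"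
    by (auto simp: RPC field_simps)
  let ?M = "mat2 (1 / a) 0 (- c / a) 1" and ?N = "mat2 1 (- b / a) 0 1"
  have "(?M ** R) ** P ** (C ** ?N) = ?M ** (R ** P ** C) ** ?N"
    by (simp only: matrix_mul_assoc)
  also have "\<dots> = mat2 1 0 0 0"
    using a by (simp add: RPC)
  finally have eq: "(?M ** R) ** P ** (C ** ?N) = mat2 1 0 0 0" .
  have "invertible ?M" "invertible ?N" "invertible R" "invertible C"
    using R C by (auto simp: a(1) intro!: invertible_mat2)
  then show thesis
    using that[OF _ _ eq] by (simp add: invertible_mult)
qed

lemma matrix_add_rdistrib: "(A + B) ** C = A ** C + B ** C"
  by (vector matrix_matrix_mult_def sum.distrib[symmetric] field_simps)

text \<open>The three determinants say that the binary quadratic form \<open>det (s P + t Q)\<close>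
  vanishes at three pairwise independent points, hence identically.\<close>

lemma singular_pencil_equiv:
  assumes "P \<noteq> 0" "det P = 0" "det Q = 0" "det (P + Q) = 0"
  shows "\<exists>c. tensor_equiv (slabs P Q) (canonical_form c)"
proof -
  obtain M N where inv: "invertible M" "invertible N" and MPN: "M ** P ** N = mat2 1 0 0 0"
    using assms by (metis singular_matrix_normal_form)
  obtain a b c d where MQN: "M ** Q ** N = mat2 a b c d"
    by (rule mat2_cases)
  have "det (M ** Q ** N) = 0" "det (M ** (P + Q) ** N) = 0"
    using assms by (simp_all add: det_mul)
  moreover have "M ** (P + Q) ** N = mat2 1 0 0 0 + mat2 a b c d"
    by (simp only: MPN[symmetric] MQN[symmetric] matrix_add_ldistrib matrix_add_rdistrib)
  \<comment> \<open>The conditions read \<open>a d = b c\<close> and \<open>(1 + a) d = b c\<close>;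
    subtracting gives \<open>d = 0\<close>, and then \<open>b c = 0\<close>.\<close>
  ultimately have "d = 0" "b = 0 \<or> c = 0"
    by (auto simp: MQN algebra_simps)
  have "tensor_equiv (slabs P Q) (slabs (mat2 1 0 0 0) (mat2 a b c d))"
    using slabs_mult_equiv[OF inv, of P Q] by (simp add: MPN MQN)
  also have "tensor_equiv \<dots> (slabs (mat2 1 0 0 0) (mat2 0 b c 0))"
    using slabs_combine_equiv[of 1 1 0 "- a" "mat2 1 0 0 0" "mat2 a b c d"] by (simp add: \<open>d = 0\<close>)
  finally have *: "tensor_equiv (slabs P Q) (slabs (mat2 1 0 0 0) (mat2 0 b c 0))" .
  consider "b = 0" "c = 0" | "b \<noteq> 0" "c = 0" | "b = 0" "c \<noteq> 0"
    using \<open>b = 0 \<or> c = 0\<close> by blast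
  then have "\<exists>x. tensor_equiv (slabs (mat2 1 0 0 0) (mat2 0 b c 0)) (canonical_form x)"
  proof cases
    case 1
    then show ?thesis
      by (metis canonical_form_slabs(2) tensor_equiv_refl)
  next
    case 2
    then have "tensor_equiv (slabs (mat2 1 0 0 0) (mat2 0 b c 0)) (canonical_form D2')"
      using slabs_combine_equiv[of 1 "1 / b" 0 0 "mat2 1 0 0 0" "mat2 0 b c 0"]
      unfolding canonical_form_slabs by simp
    then show ?thesis ..
  next
    case 3
    then have "tensor_equiv (slabs (mat2 1 0 0 0) (mat2 0 b c 0)) (canonical_form D2'')"
      using slabs_combine_equiv[of 1 "1 / c" 0 0 "mat2 1 0 0 0" "mat2 0 b c 0"]
      unfolding canonical_form_slabs by simp
    then show ?thesis ..
  qed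
  with * show ?thesis
    by (blast intro: tensor_equiv_trans)
qed

text \<open>The second slab squares to \<open>\<delta>\<close> times the identity: it is nilpotent,
  has two opposite real eigenvalues, or is similar to a multiple of a quarter turn.\<close>

lemma companion_pencil_equiv:
  "\<exists>c. tensor_equiv (slabs (mat2 1 0 0 1) (mat2 0 \<delta> 1 0)) (canonical_form c)"
proof -
  let ?A = "slabs (mat2 1 0 0 1) (mat2 0 \<delta> 1 0)"
  consider "\<delta> = 0" | "\<delta> > 0" | "\<delta> < 0"
    by linarith
  then show ?thesis
  proof cases
    case 1
    \<comment> \<open>Exchanging the rows turns the nilpotent slab into a diagonal matrix unit and
      the identity into the swap matrix.\<close>
    have "tensor_equiv ?A (slabs (mat2 0 1 1 0) (mat2 1 0 0 0))"
      using slabs_mult_equiv[of "mat2 0 1 1 0" "mat2 1 0 0 1" "mat2 1 0 0 1" "mat2 0 \<delta> 1 0"]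
      by (simp add: 1 invertible_mat2)
    also have "tensor_equiv \<dots> (canonical_form D3)"
      unfolding canonical_form_slabs by (rule slabs_swap_equiv)
    finally show ?thesis ..
  next
    case 2
    define s where "s = sqrt \<delta>"
    have s: "s > 0" "\<delta> = s * s"
      using 2 by (simp_all add: s_def)
    \<comment> \<open>New slabs: the spectral projections of the companion matrix; the columns of the second
      factor below are its eigenvectors.\<close>
    have "tensor_equiv ?A (slabs (mat2 (1/2) (s/2) (1/(2 * s)) (1/2))
        (mat2 (1/2) (-s/2) (-1/(2 * s)) (1/2)))"
      using slabs_combine_equiv[of "1/2" "-1/(2 * s)" "1/(2 * s)" "1/2" "mat2 1 0 0 1" "mat2 0 \<delta> 1 0"] s
      by simp
    also have "tensor_equiv \<dots> (canonical_form G2)"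
      using slabs_mult_equiv[of "mat2 (1/(2 * s)) (1/2) (-1/(2 * s)) (1/2)" "mat2 s (-s) 1 1"
          "mat2 (1/2) (s/2) (1/(2 * s)) (1/2)" "mat2 (1/2) (-s/2) (-1/(2 * s)) (1/2)"] s
      unfolding canonical_form_slabs by (simp add: invertible_mat2)
    finally show ?thesis ..
  next
    case 3
    define s where "s = sqrt (- \<delta>)"
    have s: "s > 0" "\<delta> = - (s * s)"
      using 3 by (simp_all add: s_def)
    \<comment> \<open>Rescaled by \<open>1/s\<close>, the second slab squares to minus the identity;
      a diagonal conjugation then makes it the quarter turn.\<close>
    have "tensor_equiv ?A (slabs (mat2 1 0 0 1) (mat2 0 (-s) (1/s) 0))"
      using slabs_combine_equiv[of 1 "1/s" 0 0 "mat2 1 0 0 1" "mat2 0 \<delta> 1 0"] s by simp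
    also have "tensor_equiv \<dots> (canonical_form G3)"
      using slabs_mult_equiv[of "mat2 (1/s) 0 0 1" "mat2 s 0 0 1"
          "mat2 1 0 0 1" "mat2 0 (-s) (1/s) 0"] s
      unfolding canonical_form_slabs by (simp add: invertible_mat2)
    finally show ?thesis ..
  qed
qed

lemma traceless_pencil_equiv:
  "\<exists>x. tensor_equiv (slabs (mat2 1 0 0 1) (mat2 p b c (- p))) (canonical_form x)"
proof (cases "p = 0 \<and> b = 0 \<and> c = 0")
  case True
  then show ?thesis
    by (metis canonical_form_slabs(3) minus_zero tensor_equiv_refl)
next
  case False
  let ?B = "mat2 p b c (- p)"
  \<comment> \<open>A vector \<open>v = (u, w)\<close> that is not an eigenvector of \<open>?B\<close> gives a basis \<open>v, ?B v\<close>, in which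
    \<open>?B\<close> is a companion matrix, as its square is scalar.\<close>
  obtain u w where uw: "u * (c * u - p * w) - (p * u + b * w) * w \<noteq> 0"
  \<comment> \<open>If \<open>?B\<close> is diagonal, its eigenvalues \<open>p\<close> and
    \<open>- p\<close> differ, so \<open>(1, 1)\<close> is no eigenvector; otherwise one of the
    coordinate vectors is none.\<close>
  proof (cases "c = 0 \<and> b = 0")
    case True
    with False that[of 1 1] show thesis by auto
  next
    case False
    with that[of 1 0] that[of 0 1] show thesis by auto
  qed
  define S where "S = mat2 u (p * u + b * w) w (c * u - p * w)"
  define C where "C = mat2 0 (p * p + b * c) 1 0"
  have "invertible S"
    using uw by (simp add: S_def invertible_mat2)
  then obtain S' where S': "S' ** S = mat 1" "S ** S' = mat 1"
    by (auto simp: invertible_def)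
  then have "invertible S'"
    by (auto simp: invertible_def)
  have "?B ** S = S ** C"
    by (simp add: S_def C_def algebra_simps)
  then have "S' ** ?B ** S = C"
    by (metis S'(1) matrix_mul_assoc matrix_mul_lid)
  then have "tensor_equiv (slabs (mat 1) ?B) (slabs (mat 1) C)"
    using slabs_mult_equiv[OF \<open>invertible S'\<close> \<open>invertible S\<close>, of "mat 1" ?B] by (simp add: S')
  also obtain x where "tensor_equiv (slabs (mat 1) C) (canonical_form x)"
    using companion_pencil_equiv by (auto simp: C_def mat_1_mat2)
  finally show ?thesis
    by (auto simp: mat_1_mat2)
qed

text \<open>Left multiplication by the inverse of \<open>P\<close> makes the first slab the
  identity; subtracting half the trace times it makes the second traceless.\<close>

lemma regular_pencil_equiv:
  assumes "det P \<noteq> 0"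
  shows "\<exists>x. tensor_equiv (slabs P Q) (canonical_form x)"
proof -
  obtain P' where P': "P' ** P = mat 1" "P ** P' = mat 1"
    using assms by (auto simp flip: invertible_det_nz simp: invertible_def)
  then have "invertible P'"
    by (auto simp: invertible_def)
  obtain a b c d where P'Q: "P' ** Q = mat2 a b c d"
    by (rule mat2_cases)
  define p where "p = (a - d) / 2"
  have shift: "(- (a + d) / 2) *\<^sub>R mat2 1 0 0 1 + 1 *\<^sub>R mat2 a b c d = mat2 p b c (- p)"
    by (simp add: p_def field_simps)
  have "tensor_equiv (slabs P Q) (slabs (mat2 1 0 0 1) (mat2 a b c d))"
    using slabs_mult_equiv[OF \<open>invertible P'\<close>, of "mat 1" P Q]
    by (simp add: P' P'Q invertible_det_nz flip: mat_1_mat2)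
  also have "tensor_equiv \<dots> (slabs (mat2 1 0 0 1) (mat2 p b c (- p)))"
    using slabs_combine_equiv[of 1 1 0 "- (a + d) / 2" "mat2 1 0 0 1" "mat2 a b c d"]
    unfolding shift by simp
  also obtain x where "tensor_equiv \<dots> (canonical_form x)"
    using traceless_pencil_equiv by blast
  finally show ?thesis ..
qed

lemma canonical_form_exists: "\<exists>c. tensor_equiv A (canonical_form c)"
proof -
  define P Q where "P = A $ 1" and "Q = A $ 2"
  have A: "A = slabs P Q"
    by (simp add: P_def Q_def slabs_collapse)
  have add: "tensor_equiv (slabs P Q) (slabs (P + Q) Q)"
    using slabs_combine_equiv[of 1 1 1 0 P Q] by simp
  have via: ?thesis if "tensor_equiv (slabs P Q) B" "\<exists>c. tensor_equiv B (canonical_form c)" for B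
    using that unfolding A by (blast intro: tensor_equiv_trans)
  \<comment> \<open>Three slab combinations decide whether the pencil is regular, as a binary
    quadratic form vanishing at all three is zero.\<close>
  consider "det P \<noteq> 0" | "det Q \<noteq> 0" | "det (P + Q) \<noteq> 0"
    | "det P = 0" "det Q = 0" "det (P + Q) = 0" "P \<noteq> 0"
    | "det P = 0" "det Q = 0" "det (P + Q) = 0" "Q \<noteq> 0"
    | "P = 0" "Q = 0"
    by blast
  then show ?thesis
  proof cases
    case 1
    then show ?thesis
      by (rule via[OF tensor_equiv_refl regular_pencil_equiv])
  next
    case 2
    then show ?thesis
      by (rule via[OF slabs_swap_equiv regular_pencil_equiv])
  next
    case 3
    then show ?thesis
      by (rule via[OF add regular_pencil_equiv])
  next
    case 4
    then show ?thesis
      by (intro via[OF tensor_equiv_refl] singular_pencil_equiv)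
  next
    case 5
    then show ?thesis
      by (intro via[OF slabs_swap_equiv] singular_pencil_equiv) (simp_all add: add.commute)
  next
    case 6
    then have "A = canonical_form D0"
      by (simp add: A vec_eq_iff forall_2)
    then show ?thesis
      by (metis tensor_equiv_refl)
  qed
qed

theorem theorem7p1:
  shows "(\<forall>A :: tensor222. \<exists>!c. tensor_equiv A (canonical_form c)) \<and>
         (\<forall>(A :: tensor222) c. tensor_equiv A (canonical_form c) \<longrightarrow>
            invariants A = listed_invariants c)"
proof -
  have inv: "invariants A = listed_invariants c" if "tensor_equiv A (canonical_form c)" for A c
    using invariants_equiv[OF that] by (simp add: invariants_canonical)
  \<comment> \<open>Two forms equivalent to \<open>A\<close> would both list the invariants of
    \<open>A\<close>, so they coincide.\<close>
  then have "\<exists>!c. tensor_equiv A (canonical_form c)" for A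
    using canonical_form_exists[of A] by (metis listed_invariants_inject)
  with inv show ?thesis
    by blast
qed

end
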